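(* Let $M < 3$ be a real number, let $d > 0$ be an integer, and let $G$ be a finite simple graph with $\mathrm{mad}(G) < M$. If $d > \frac{2}{3-M} - 2$, then $V(G)$ can be partitioned into sets $A$ and $B$ such that $A$ is an independent set of $G$ and $G[B]$ is a forest each of whose connected components has at most $d+1$ vertices.
   Context: $\mathrm{mad}(G) := \max_{H \subseteq G,\, V(H)\neq\emptyset} \frac{2|E(H)|}{|V(H)|}$ (maximum average degree over nonempty subgraphs). *)

theory Defs
  imports Complex_Main
begin

definition simple_graph :: "'a set \<Rightarrow> 'a set set \<Rightarrow> bool" where
  "simple_graph V E \<longleftrightarrow> finite V \<and> (\<forall>e\<in>E. e \<subseteq> V \<and> card e = 2)"

definition subgraph :: "'a set \<Rightarrow> 'a set set \<Rightarrow> 'a set \<Rightarrow> 'a set set \<Rightarrow> bool" where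
  "subgraph V' E' V E \<longleftrightarrow> V' \<subseteq> V \<and> E' \<subseteq> E \<and> (\<forall>e\<in>E'. e \<subseteq> V')"

definition mad :: "'a set \<Rightarrow> 'a set set \<Rightarrow> real" where
  "mad V E = Max {2 * real (card E') / real (card V') | V' E'. subgraph V' E' V E \<and> V' \<noteq> {}}"

definition independent_set :: "'a set set \<Rightarrow> 'a set \<Rightarrow> bool" where
  "independent_set E A \<longleftrightarrow> (\<forall>x\<in>A. \<forall>y\<in>A. {x, y} \<notin> E)"

definition induced_edges :: "'a set set \<Rightarrow> 'a set \<Rightarrow> 'a set set" where
  "induced_edges E B = {e \<in> E. e \<subseteq> B}"

definition adj :: "'a set set \<Rightarrow> 'a \<Rightarrow> 'a \<Rightarrow> bool" where
  "adj E x y \<longleftrightarrow> {x, y} \<in> E"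

definition is_cycle :: "'a set \<Rightarrow> 'a set set \<Rightarrow> 'a list \<Rightarrow> bool" where
  "is_cycle V E c \<longleftrightarrow> length c \<ge> 3 \<and> distinct c \<and> set c \<subseteq> V \<and>
     (\<forall>i < length c - 1. adj E (c ! i) (c ! Suc i)) \<and> adj E (last c) (hd c)"

definition forest :: "'a set \<Rightarrow> 'a set set \<Rightarrow> bool" where
  "forest V E \<longleftrightarrow> (\<nexists>c. is_cycle V E c)"

definition component :: "'a set \<Rightarrow> 'a set set \<Rightarrow> 'a \<Rightarrow> 'a set" where
  "component V E x = {y. (\<lambda>u v. u \<in> V \<and> v \<in> V \<and> adj E u v)\<^sup>*\<^sup>* x y}"

end

theory Submission
  imports Defs "HOL-Analysis.Function_Topology"
begin

text \<open>
  Deleting a suitable independent set \<open>I\<close> lowers the maximum average degree by \<open>1\<close>, up to an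
  arbitrarily small error. The remaining graph then has maximum average degree at most
  \<open>M - 1 < 2\<close>, which excludes cycles as well as trees on more than \<open>2 / (3 - M)\<close> vertices.

  To find \<open>I\<close>, split two units of every edge between its two ends so as to minimise
  \<open>(\<Sum> load\<^sup>2) + \<epsilon> (\<Sum> share\<^sup>2)\<close>, where the load of a vertex is the sum of its shares. The first
  term keeps all loads below \<open>mad(G) + O(\<epsilon>)\<close>. The second one ensures that of the two ends of an
  edge, the one with the smaller load has a share of at least \<open>1\<close>. Choosing \<open>I\<close> greedily by
  decreasing load, every vertex outside \<open>I\<close> has a neighbour in \<open>I\<close> of at least its own load, hence
  loses at least one unit when \<open>I\<close> is deleted. The loads that remain bound the number of edges of
  every subgraph avoiding \<open>I\<close>.
\<close>

section \<open>Edges of induced subgraphs\<close>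

lemma simple_graph_edgeD:
  assumes "simple_graph V E" "{u, w} \<in> E"
  shows "u \<in> V" "w \<in> V" "u \<noteq> w"
  using assms unfolding simple_graph_def by (auto dest!: bspec[of _ _ "{u, w}"])

lemma simple_graph_finite:
  assumes "simple_graph V E"
  shows "finite V" "finite E"
proof -
  show "finite V" using assms unfolding simple_graph_def by simp
  moreover have "E \<subseteq> Pow V" using assms unfolding simple_graph_def by auto
  ultimately show "finite E" by (meson finite_Pow_iff finite_subset)
qed

lemma finite_induced_edges: "finite E \<Longrightarrow> finite (induced_edges E X)"
  unfolding induced_edges_def by simp

lemma induced_edges_induced_edges:
  "X \<subseteq> Y \<Longrightarrow> induced_edges (induced_edges E Y) X = induced_edges E X"
  unfolding induced_edges_def by auto

lemma card_induced_edges_insert: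
  assumes "finite E" "u \<in> X" "v \<notin> X" "{u, v} \<in> E"
  shows "card (induced_edges E X) < card (induced_edges E (insert v X))"
proof (rule psubset_card_mono)
  have "{u, v} \<in> induced_edges E (insert v X) - induced_edges E X"
    using assms unfolding induced_edges_def by simp
  moreover have "induced_edges E X \<subseteq> induced_edges E (insert v X)"
    unfolding induced_edges_def by auto
  ultimately show "induced_edges E X \<subset> induced_edges E (insert v X)" by blast
qed (rule finite_induced_edges[OF assms(1)])

lemma card_adjacent_pairs:
  assumes "simple_graph V E" "finite X"
  shows "card {p \<in> X \<times> X. {fst p, snd p} \<in> E} = 2 * card (induced_edges E X)"
proof -
  let ?S = "{p \<in> X \<times> X. {fst p, snd p} \<in> E}" and ?T = "induced_edges E X"
  have "card {p \<in> ?S. {fst p, snd p} = e} = 2" if e: "e \<in> ?T" for e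
  proof -
    have "card e = 2" "e \<in> E" "e \<subseteq> X"
      using e assms(1) unfolding induced_edges_def simple_graph_def by auto
    then obtain a b where ends: "e = {a, b}" "a \<noteq> b"
      by (auto simp: card_2_iff)
    then have "{p \<in> ?S. {fst p, snd p} = e} = {(a, b), (b, a)}"
      using \<open>e \<in> E\<close> \<open>e \<subseteq> X\<close> by (auto simp: doubleton_eq_iff insert_commute)
    then show ?thesis using ends(2) by simp
  qed
  then have "(\<Sum>p\<in>?S. card {e \<in> ?T. {fst p, snd p} = e}) = 2 * card ?T"
    using assms simple_graph_finite(2) by (intro sum_multicount)
      (auto intro: finite_induced_edges)
  moreover have "{e \<in> ?T. {fst p, snd p} = e} = {{fst p, snd p}}" if "p \<in> ?S" for p
    using that unfolding induced_edges_def by auto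
  ultimately show ?thesis by simp
qed

lemma is_cycle_adj_mod:
  assumes "is_cycle V E c" "i < length c"
  shows "{c ! i, c ! (Suc i mod length c)} \<in> E"
proof (cases "Suc i = length c")
  case True
  then have "c \<noteq> []" "i = length c - 1" by auto
  then have "c ! i = last c" "c ! (Suc i mod length c) = hd c"
    by (simp_all add: True last_conv_nth hd_conv_nth)
  then show ?thesis using assms(1) unfolding is_cycle_def adj_def by simp
next
  case False
  then show ?thesis using assms unfolding is_cycle_def adj_def by auto
qed

lemma card_induced_edges_cycle:
  assumes "finite E" "is_cycle V E c"
  shows "length c \<le> card (induced_edges E (set c))"
proof -
  define n where "n = length c"
  define edge where "edge i = (!) c ` {i, Suc i mod n}" for i
  have len: "n \<ge> 3" and dist: "distinct c"
    using assms(2) unfolding is_cycle_def n_def by auto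
  have succ: "Suc i mod n < n" for i using len by simp
  have "inj_on edge {..<n}"
  proof (rule inj_onI)
    fix i j assume ij: "i \<in> {..<n}" "j \<in> {..<n}" and "edge i = edge j"
    have "inj_on ((!) c) {..<n}"
      using dist unfolding n_def by (rule inj_on_nth) simp
    moreover have "{i, Suc i mod n} \<subseteq> {..<n}" "{j, Suc j mod n} \<subseteq> {..<n}"
      using ij succ by auto
    ultimately have "{i, Suc i mod n} = {j, Suc j mod n}"
      using \<open>edge i = edge j\<close> unfolding edge_def by (simp only: inj_on_image_eq_iff)
    then show "i = j"
      using len ij by (auto simp: doubleton_eq_iff mod_Suc split: if_splits)
  qed
  moreover have "edge ` {..<n} \<subseteq> induced_edges E (set c)"
    using is_cycle_adj_mod[OF assms(2)] succ
    unfolding edge_def induced_edges_def n_def by auto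
  ultimately have "card {..<n} \<le> card (induced_edges E (set c))"
    using finite_induced_edges[OF assms(1)] by (rule card_inj_on_le)
  then show ?thesis by (simp add: n_def)
qed

lemma card_le_Suc_card_induced_edges_if_connected:
  assumes "finite C" "finite E" "x \<in> C"
    and cut: "\<And>P. P \<subset> C \<Longrightarrow> x \<in> P \<Longrightarrow> \<exists>u\<in>P. \<exists>v\<in>C - P. {u, v} \<in> E"
  shows "card C \<le> Suc (card (induced_edges E C))"
proof -
  define \<P> where "\<P> = {P. P \<subseteq> C \<and> x \<in> P \<and> card P \<le> Suc (card (induced_edges E P))}"
  have "finite \<P>" "{x} \<in> \<P>"
    using assms(1,3) unfolding \<P>_def by auto
  from finite_has_maximal2[OF this]
  obtain P where P: "P \<in> \<P>" and max: "\<forall>Q\<in>\<P>. P \<subseteq> Q \<longrightarrow> P = Q" by blast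
  have "P = C"
  proof (rule ccontr)
    assume "P \<noteq> C"
    then obtain u v where crossing: "u \<in> P" "v \<in> C - P" "{u, v} \<in> E"
      using cut[of P] P unfolding \<P>_def by blast
    have "card (insert v P) \<le> Suc (card (induced_edges E (insert v P)))"
      using P crossing card_induced_edges_insert[OF assms(2), of u P v]
        finite_subset[OF _ assms(1)] unfolding \<P>_def by auto
    then have "insert v P \<in> \<P>"
      using P crossing unfolding \<P>_def by simp
    then have "P = insert v P" using max by blast
    then show False using crossing(2) by blast
  qed
  then show ?thesis using P unfolding \<P>_def by simp
qed

lemma component_subset: "x \<in> V \<Longrightarrow> component V E x \<subseteq> V"
  unfolding component_def by (auto elim: rtranclp.cases)

lemma component_self: "x \<in> component V E x"
  unfolding component_def by simp

lemma card_component_le_Suc_card_induced_edges: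
  assumes "finite V" "finite E" "x \<in> V"
  shows "card (component V E x) \<le> Suc (card (induced_edges E (component V E x)))"
proof (rule card_le_Suc_card_induced_edges_if_connected[OF _ assms(2) component_self])
  let ?step = "\<lambda>u v. u \<in> V \<and> v \<in> V \<and> adj E u v"
  show "finite (component V E x)"
    using component_subset[OF assms(3)] assms(1) by (rule finite_subset)
  fix P assume P: "P \<subset> component V E x" "x \<in> P"
  have "\<exists>u\<in>P. \<exists>v. v \<notin> P \<and> ?step u v"
  proof (rule ccontr)
    assume closed: "\<not> ?thesis"
    have "y \<in> P" if "?step\<^sup>*\<^sup>* x y" for y
      using that by (induction rule: rtranclp_induct) (use P(2) closed in auto)
    then show False using P(1) unfolding component_def by blast
  qed
  then obtain u v where crossing: "u \<in> P" "v \<notin> P" "?step u v" by blast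
  moreover have "v \<in> component V E x"
    using P(1) crossing unfolding component_def by (auto intro: rtranclp.rtrancl_into_rtrancl)
  ultimately show "\<exists>u\<in>P. \<exists>v\<in>component V E x - P. {u, v} \<in> E"
    unfolding adj_def by blast
qed

section \<open>Graphs of bounded maximum average degree\<close>

definition mad_at_most :: "'a set \<Rightarrow> 'a set set \<Rightarrow> real \<Rightarrow> bool" where
  "mad_at_most V E \<mu> \<longleftrightarrow>
    (\<forall>X\<subseteq>V. 2 * real (card (induced_edges E X)) \<le> \<mu> * real (card X))"

lemma mad_at_mostD:
  "mad_at_most V E \<mu> \<Longrightarrow> X \<subseteq> V \<Longrightarrow> 2 * real (card (induced_edges E X)) \<le> \<mu> * real (card X)"
  unfolding mad_at_most_def by blast

lemma mad_at_most_induced_edges: "mad_at_most V (induced_edges E V) \<mu> \<longleftrightarrow> mad_at_most V E \<mu>"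
  unfolding mad_at_most_def by (simp add: induced_edges_induced_edges)

lemma mad_at_most_mad:
  assumes G: "simple_graph V E"
  shows "mad_at_most V E (mad V E)"
  unfolding mad_at_most_def
proof (intro allI impI)
  fix X assume X: "X \<subseteq> V"
  let ?D = "{2 * real (card E') / real (card V') | V' E'. subgraph V' E' V E \<and> V' \<noteq> {}}"
  note fin = simple_graph_finite[OF G]
  show "2 * real (card (induced_edges E X)) \<le> mad V E * real (card X)"
  proof (cases "X = {}")
    case True
    then show ?thesis
      using G unfolding induced_edges_def simple_graph_def by (auto simp: card_eq_0_iff)
  next
    case False
    have "?D \<subseteq> (\<lambda>(V', E'). 2 * real (card E') / real (card V')) ` (Pow V \<times> Pow E)"
      unfolding subgraph_def by auto
    then have "finite ?D"
      using fin by (meson finite_Pow_iff finite_SigmaI finite_imageI finite_subset)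
    moreover have "subgraph X (induced_edges E X) V E"
      using X unfolding subgraph_def induced_edges_def by auto
    then have "2 * real (card (induced_edges E X)) / real (card X) \<in> ?D"
      using False by blast
    ultimately have "2 * real (card (induced_edges E X)) / real (card X) \<le> mad V E"
      unfolding mad_def by (rule Max_ge)
    moreover have "card X > 0"
      using False finite_subset[OF X fin(1)] by (simp add: card_gt_0_iff)
    ultimately show ?thesis by (simp add: field_simps)
  qed
qed

lemma forest_if_mad_at_most:
  assumes "finite E" "mad_at_most V E \<mu>" "\<mu> < 2"
  shows "forest V E"
  unfolding forest_def
proof
  assume "\<exists>c. is_cycle V E c"
  then obtain c where cycle: "is_cycle V E c" by blast
  then have "set c \<subseteq> V" "card (set c) = length c" "length c > 0"
    unfolding is_cycle_def by (auto simp: distinct_card)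
  then have "2 * real (card (induced_edges E (set c))) \<le> \<mu> * real (length c)"
    using mad_at_mostD[OF assms(2), of "set c"] by simp
  also have "\<dots> < 2 * real (length c)"
    using assms(3) \<open>length c > 0\<close> by simp
  finally show False using card_induced_edges_cycle[OF assms(1) cycle] by simp
qed

lemma card_component_bound_if_mad_at_most:
  assumes "finite V" "finite E" "mad_at_most V E \<mu>" "x \<in> V"
  shows "(2 - \<mu>) * real (card (component V E x)) \<le> 2"
  using card_component_le_Suc_card_induced_edges[OF assms(1,2,4)]
    mad_at_mostD[OF assms(3) component_subset[OF assms(4)], of E]
  by (simp add: left_diff_distrib)

section \<open>Balanced distribution of the edges\<close>

text \<open>
  \<^term>\<open>x (u, w)\<close> is the share of \<^term>\<open>u\<close> in the edge \<^term>\<open>{u, w}\<close>. An edge carries two units,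
  so that the average load is the average degree.
\<close>

definition edge_split :: "'a set set \<Rightarrow> ('a \<times> 'a \<Rightarrow> real) \<Rightarrow> bool" where
  "edge_split E x \<longleftrightarrow> (\<forall>p. 0 \<le> x p) \<and>
     (\<forall>u w. x (u, w) + x (w, u) = (if {u, w} \<in> E then 2 else 0))"

definition load :: "'a set \<Rightarrow> ('a \<times> 'a \<Rightarrow> real) \<Rightarrow> 'a \<Rightarrow> real" where
  "load V x v = (\<Sum>w\<in>V. x (v, w))"

definition balanced :: "'a set \<Rightarrow> real \<Rightarrow> ('a \<times> 'a \<Rightarrow> real) \<Rightarrow> bool" where
  "balanced V \<epsilon> x \<longleftrightarrow>
     (\<forall>u w. 0 < x (u, w) \<longrightarrow> load V x u + \<epsilon> * x (u, w) \<le> load V x w + \<epsilon> * x (w, u))"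

lemma edge_split_nonneg: "edge_split E x \<Longrightarrow> 0 \<le> x p"
  unfolding edge_split_def by blast

lemma edge_split_add: "edge_split E x \<Longrightarrow> x (u, w) + x (w, u) = (if {u, w} \<in> E then 2 else 0)"
  unfolding edge_split_def by blast

lemma edge_split_le: "edge_split E x \<Longrightarrow> x (u, w) \<le> 2"
  using edge_split_add[of E x u w] edge_split_nonneg[of E x "(w, u)"] by (simp split: if_splits)

lemma edge_split_posD: "edge_split E x \<Longrightarrow> 0 < x (u, w) \<Longrightarrow> {u, w} \<in> E"
  using edge_split_add[of E x u w] edge_split_nonneg[of E x "(w, u)"] by (simp split: if_splits)

lemma sum_load:
  assumes "simple_graph V E" "edge_split E x" "finite X"
  shows "(\<Sum>v\<in>X. load X x v) = 2 * real (card (induced_edges E X))"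
proof -
  have "2 * (\<Sum>v\<in>X. load X x v) = (\<Sum>u\<in>X. \<Sum>w\<in>X. x (u, w)) + (\<Sum>u\<in>X. \<Sum>w\<in>X. x (w, u))"
    unfolding load_def by (simp add: sum.swap[of "\<lambda>u w. x (w, u)"])
  also have "\<dots> = (\<Sum>u\<in>X. \<Sum>w\<in>X. if {u, w} \<in> E then 2 else 0)"
    by (simp add: edge_split_add[OF assms(2)] flip: sum.distrib)
  also have "\<dots> = (\<Sum>p\<in>X \<times> X. if {fst p, snd p} \<in> E then 2 else 0)"
    by (simp add: sum.cartesian_product case_prod_beta)
  also have "\<dots> = (\<Sum>p\<in>{p \<in> X \<times> X. {fst p, snd p} \<in> E}. 2)"
    using assms(3) by (intro sum.inter_filter[symmetric]) simp
  also have "\<dots> = 2 * (2 * real (card (induced_edges E X)))"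
    by (simp add: card_adjacent_pairs[OF assms(1,3)])
  finally show ?thesis by simp
qed

lemma sum_load_closed:
  assumes "simple_graph V E" "edge_split E x" "R \<subseteq> V"
    and "\<And>u w. u \<in> R \<Longrightarrow> w \<notin> R \<Longrightarrow> x (u, w) = 0"
  shows "(\<Sum>v\<in>R. load V x v) = 2 * real (card (induced_edges E R))"
proof -
  note fin = simple_graph_finite(1)[OF assms(1)]
  have "(\<Sum>v\<in>R. load V x v) = (\<Sum>v\<in>R. load R x v)"
    unfolding load_def using assms(3,4) fin by (intro sum.cong sum.mono_neutral_right) auto
  then show ?thesis
    using sum_load[OF assms(1,2) finite_subset[OF assms(3) fin]] by simp
qed

lemma load_mono:
  assumes "edge_split E x" "finite V" "P \<subseteq> V"
  shows "load P x v \<le> load V x v"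
  unfolding load_def using assms edge_split_nonneg by (intro sum_mono2) auto

lemma mad_at_most_if_load_le:
  assumes "simple_graph V E" "edge_split E x" "finite W" "\<And>v. v \<in> W \<Longrightarrow> load W x v \<le> \<mu>"
  shows "mad_at_most W E \<mu>"
  unfolding mad_at_most_def
proof (intro allI impI)
  fix P assume P: "P \<subseteq> W"
  have "(\<Sum>v\<in>P. load P x v) \<le> real (card P) * \<mu>"
    using P assms(4) load_mono[OF assms(2,3) P]
    by (intro sum_bounded_above) (meson order_trans subsetD)
  then show "2 * real (card (induced_edges E P)) \<le> \<mu> * real (card P)"
    using sum_load[OF assms(1,2) finite_subset[OF P assms(3)]] by (simp add: mult.commute)
qed

lemma load_add_share_le:
  assumes "edge_split E x" "finite V" "P \<subseteq> V" "z \<in> V - P"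
  shows "load P x v + x (v, z) \<le> load V x v"
proof -
  have "load P x v + x (v, z) = load (insert z P) x v"
    using assms(4) finite_subset[OF assms(3,2)] unfolding load_def by simp
  also have "\<dots> \<le> load V x v"
    using assms by (intro load_mono) auto
  finally show ?thesis .
qed

lemma compact_edge_splits: "compact {x. edge_split E x}"
proof -
  have "closed {x. edge_split E x}"
    unfolding edge_split_def
    by (intro closed_Collect_conj closed_Collect_all closed_Collect_le closed_Collect_eq
        continuous_on_add continuous_on_const continuous_on_product_coordinates)
  moreover have "compact (UNIV \<rightarrow>\<^sub>E {0..2::real})"
    using compactin_PiE[of "\<lambda>_. euclidean" UNIV "\<lambda>_. {0..2::real}"]
    by (simp add: euclidean_product_topology)
  moreover have "{x. edge_split E x} \<subseteq> UNIV \<rightarrow>\<^sub>E {0..2}"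
    using edge_split_nonneg edge_split_le by fastforce
  ultimately show ?thesis
    by (metis closed_Int_compact inf.absorb_iff1)
qed

definition shift_mass :: "'b \<Rightarrow> 'b \<Rightarrow> 'c \<Rightarrow> ('b \<Rightarrow> 'c) \<Rightarrow> 'b \<Rightarrow> 'c::ab_group_add" where
  "shift_mass a b t f i = f i - (if i = a then t else 0) + (if i = b then t else 0)"

lemma sum_squares_shift_mass:
  fixes f :: "'b \<Rightarrow> 'c::comm_ring_1"
  assumes "finite S" "a \<in> S" "b \<in> S" "a \<noteq> b"
  shows "(\<Sum>i\<in>S. (shift_mass a b t f i)\<^sup>2) = (\<Sum>i\<in>S. (f i)\<^sup>2) + 2 * t * (f b - f a + t)"
proof -
  have "(shift_mass a b t f i)\<^sup>2
      = (f i)\<^sup>2 + (if i = a then t\<^sup>2 - 2 * t * f a else 0)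
        + (if i = b then t\<^sup>2 + 2 * t * f b else 0)" for i
    using assms(4) unfolding shift_mass_def by (simp add: power2_eq_square algebra_simps)
  then show ?thesis
    using assms by (simp add: sum.distrib power2_eq_square algebra_simps)
qed

lemma load_shift_mass:
  assumes "finite V" "u \<in> V" "w \<in> V"
  shows "load V (shift_mass (u, w) (w, u) t x) = shift_mass u w t (load V x)"
proof
  show "load V (shift_mass (u, w) (w, u) t x) v = shift_mass u w t (load V x) v" for v
    using assms unfolding load_def shift_mass_def
    by (cases "v = u"; cases "v = w") (simp_all add: sum.distrib sum_subtractf)
qed

lemma edge_split_shift_mass:
  assumes "edge_split E x" "0 \<le> t" "t \<le> x (u, w)"
  shows "edge_split E (shift_mass (u, w) (w, u) t x)"
proof -
  let ?y = "shift_mass (u, w) (w, u) t x"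
  have "0 \<le> ?y p" for p
    using edge_split_nonneg[OF assms(1), of p] assms(2,3) by (simp add: shift_mass_def)
  moreover have "?y (a, b) + ?y (b, a) = x (a, b) + x (b, a)" for a b
    by (simp add: shift_mass_def conj_commute)
  ultimately show ?thesis
    using assms(1) unfolding edge_split_def by simp
qed

lemma edge_split_attains_min:
  fixes \<Phi> :: "('a \<times> 'a \<Rightarrow> real) \<Rightarrow> real"
  assumes "continuous_on UNIV \<Phi>"
  obtains x where "edge_split E x" "\<And>y. edge_split E y \<Longrightarrow> \<Phi> x \<le> \<Phi> y"
proof -
  have "edge_split E (\<lambda>(u, w). if {u, w} \<in> E then 1 else 0)"
    unfolding edge_split_def by (auto simp: insert_commute)
  then show thesis
    using that continuous_attains_inf[OF compact_edge_splits, of E \<Phi>]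
      continuous_on_subset[OF assms subset_UNIV] by blast
qed

lemma ex_balanced_edge_split:
  assumes G: "simple_graph V E" and "0 \<le> \<epsilon>"
  obtains x where "edge_split E x" "balanced V \<epsilon> x"
proof -
  define \<Phi> where "\<Phi> x = (\<Sum>v\<in>V. (load V x v)\<^sup>2) + \<epsilon> * (\<Sum>p\<in>V \<times> V. (x p)\<^sup>2)" for x
  note fin = simple_graph_finite(1)[OF G]
  have "continuous_on UNIV \<Phi>"
    unfolding \<Phi>_def load_def by (intro continuous_intros continuous_on_product_coordinates)
  then obtain x where x: "edge_split E x" and min: "\<And>y. edge_split E y \<Longrightarrow> \<Phi> x \<le> \<Phi> y"
    using edge_split_attains_min[of \<Phi> E] by blast
  have "load V x u + \<epsilon> * x (u, w) \<le> load V x w + \<epsilon> * x (w, u)" if pos: "0 < x (u, w)" for u w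
  proof (rule field_le_epsilon)
    fix e :: real assume "0 < e"
    note ends = simple_graph_edgeD[OF G edge_split_posD[OF x pos]]
    define t where "t = min (x (u, w)) (e / (1 + \<epsilon>))"
    have t_bounds: "0 < t" "t \<le> x (u, w)" "t \<le> e / (1 + \<epsilon>)"
      using pos \<open>0 < e\<close> assms(2) unfolding t_def by auto
    have "\<Phi> x \<le> \<Phi> (shift_mass (u, w) (w, u) t x)"
      using t_bounds by (intro min edge_split_shift_mass[OF x]) auto
    also have "\<dots> = \<Phi> x + 2 * t * (load V x w - load V x u + t)
        + \<epsilon> * (2 * t * (x (w, u) - x (u, w) + t))"
      using fin ends unfolding \<Phi>_def load_shift_mass[OF fin ends(1,2)]
      by (simp add: sum_squares_shift_mass distrib_left)
    finally have "0 \<le> (2 * t) * (load V x w - load V x u + t + \<epsilon> * (x (w, u) - x (u, w) + t))"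
      by (simp add: algebra_simps)
    then have "0 \<le> load V x w - load V x u + t + \<epsilon> * (x (w, u) - x (u, w) + t)"
      using t_bounds(1) by (simp add: zero_le_mult_iff)
    then show "load V x u + \<epsilon> * x (u, w) \<le> load V x w + \<epsilon> * x (w, u) + e"
      using t_bounds(3) assms(2) by (simp add: pos_le_divide_eq algebra_simps)
  qed
  then show thesis
    using that[OF x] unfolding balanced_def by blast
qed

lemma balanced_load_le:
  assumes "edge_split E x" "balanced V \<epsilon> x" "0 \<le> \<epsilon>" "0 < x (u, w)"
  shows "load V x u \<le> load V x w + 2 * \<epsilon>"
proof -
  have "load V x u \<le> load V x w + \<epsilon> * (x (w, u) - x (u, w))"
    using assms(2,4) unfolding balanced_def by (simp add: algebra_simps)
  also have "\<epsilon> * (x (w, u) - x (u, w)) \<le> \<epsilon> * 2"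
    using edge_split_le[OF assms(1), of w u] assms(3,4) by (intro mult_left_mono) auto
  finally show ?thesis by simp
qed

lemma balanced_share_ge_1:
  assumes "edge_split E x" "balanced V \<epsilon> x" "0 < \<epsilon>" "{v, z} \<in> E" "load V x v \<le> load V x z"
  shows "1 \<le> x (v, z)"
proof (rule ccontr)
  assume "\<not> 1 \<le> x (v, z)"
  then have share_gt: "0 < x (z, v)" "x (v, z) < x (z, v)"
    using edge_split_add[OF assms(1), of v z] assms(4) by auto
  have "load V x z + \<epsilon> * x (z, v) \<le> load V x v + \<epsilon> * x (v, z)"
    using assms(2) share_gt(1) unfolding balanced_def by blast
  moreover have "\<epsilon> * x (v, z) < \<epsilon> * x (z, v)"
    using share_gt(2) assms(3) by simp
  ultimately show False using assms(5) by linarith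
qed

lemma relpow_descent_le:
  fixes f :: "'b \<Rightarrow> 'c::linordered_semidom"
  assumes "(v, w) \<in> S ^^ n" "\<And>a b. (a, b) \<in> S \<Longrightarrow> f a \<le> f b + g"
  shows "f v \<le> f w + of_nat n * g"
  using assms(1)
proof (induction n arbitrary: w)
  case (Suc n)
  then obtain u where "(v, u) \<in> S ^^ n" "(u, w) \<in> S" by auto
  then have "f v \<le> f u + of_nat n * g" "f u \<le> f w + g"
    using Suc.IH assms(2) by blast+
  then have "f v \<le> f w + g + of_nat n * g"
    by (meson add_right_mono order_trans)
  then show ?case by (simp add: algebra_simps)
qed simp

lemma rtrancl_descent_le:
  fixes f :: "'b \<Rightarrow> 'c::linordered_semidom"
  assumes "finite S" "0 \<le> g" "(v, w) \<in> S\<^sup>*" "\<And>a b. (a, b) \<in> S \<Longrightarrow> f a \<le> f b + g"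
  shows "f v \<le> f w + of_nat (card S) * g"
proof -
  obtain n where steps: "n \<le> card S" "(v, w) \<in> S ^^ n"
    using assms(3) unfolding rtrancl_finite_eq_relpow[OF assms(1)] by auto
  have "f v \<le> f w + of_nat n * g"
    using steps(2) assms(4) by (rule relpow_descent_le)
  also have "\<dots> \<le> f w + of_nat (card S) * g"
    using steps(1) assms(2) by (intro add_left_mono mult_right_mono) auto
  finally show ?thesis .
qed

lemma load_le_mad_plus_gap:
  assumes G: "simple_graph V E" and x: "edge_split E x" and mad: "mad_at_most V E \<mu>"
    and "0 \<le> g" "v \<in> V"
    and gap: "\<And>u w. 0 < x (u, w) \<Longrightarrow> load V x u \<le> load V x w + g"
  shows "load V x v \<le> \<mu> + real ((card V)\<^sup>2) * g"
proof -
  define S where "S = {(u, w). 0 < x (u, w)}"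
  define R where "R = S\<^sup>* `` {v}"
  note fin = simple_graph_finite(1)[OF G]
  have S_subset: "S \<subseteq> V \<times> V"
    using simple_graph_edgeD[OF G edge_split_posD[OF x]] unfolding S_def by blast
  then have finS: "finite S" and cardS: "card S \<le> (card V)\<^sup>2"
    using fin card_mono[OF _ S_subset] finite_subset
    by (auto simp: card_cartesian_product power2_eq_square)
  have reach: "R \<subseteq> V" "v \<in> R"
    using S_subset assms(5) unfolding R_def by (auto elim: rtrancl.cases)
  then have finR: "finite R" using fin finite_subset by blast
  have descent: "load V x v - real ((card V)\<^sup>2) * g \<le> load V x w" if w: "w \<in> R" for w
  proof -
    have "load V x v \<le> load V x w + real (card S) * g"
      using w gap unfolding R_def S_def
      by (intro rtrancl_descent_le[OF finS[unfolded S_def] assms(4)]) auto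
    moreover have "real (card S) * g \<le> real ((card V)\<^sup>2) * g"
      using cardS assms(4) by (intro mult_right_mono) auto
    ultimately show ?thesis by simp
  qed
  have closed: "x (u, w) = 0" if "u \<in> R" "w \<notin> R" for u w
  proof -
    have "(u, w) \<notin> S"
      using that unfolding R_def by (auto intro: rtrancl.rtrancl_into_rtrancl)
    then show ?thesis using edge_split_nonneg[OF x, of "(u, w)"] unfolding S_def by simp
  qed
  have "real (card R) * (load V x v - real ((card V)\<^sup>2) * g) \<le> (\<Sum>u\<in>R. load V x u)"
    using descent by (rule sum_bounded_below)
  also have "\<dots> \<le> real (card R) * \<mu>"
    using mad_at_mostD[OF mad reach(1)]
    by (simp add: sum_load_closed[OF G x reach(1) closed] mult.commute)
  finally have "load V x v - real ((card V)\<^sup>2) * g \<le> \<mu>"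
    using reach(2) finR by (auto simp: mult_le_cancel_left card_gt_0_iff)
  then show ?thesis by simp
qed

section \<open>Lowering the maximum average degree\<close>

lemma ex_independent_set_dominating_upwards:
  fixes l :: "'a \<Rightarrow> 'b::linorder"
  assumes "finite V" "\<And>v. {v} \<notin> E"
  obtains I where "I \<subseteq> V" "independent_set E I"
    "\<And>v. v \<in> V - I \<Longrightarrow> \<exists>z\<in>I. {v, z} \<in> E \<and> l v \<le> l z"
proof -
  have "\<exists>I\<subseteq>V. independent_set E I \<and> (\<forall>v\<in>V - I. \<exists>z\<in>I. {v, z} \<in> E \<and> l v \<le> l z)"
    using assms(1)
  proof (induction V rule: finite_psubset_induct)
    case (psubset V)
    show ?case
    proof (cases "V = {}")
      case True
      then show ?thesis by (auto simp: independent_set_def)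
    next
      case False
      then have "Max (l ` V) \<in> l ` V" using psubset.hyps by simp
      then obtain u where u: "u \<in> V" "l u = Max (l ` V)" by force
      have top: "l v \<le> l u" if "v \<in> V" for v
        using that u(2) psubset.hyps by simp
      define W where "W = {v \<in> V. v \<noteq> u \<and> {v, u} \<notin> E}"
      have "W \<subset> V" using u(1) unfolding W_def by auto
      from psubset.IH[OF this] obtain I where I: "I \<subseteq> W" "independent_set E I"
        "\<And>v. v \<in> W - I \<Longrightarrow> \<exists>z\<in>I. {v, z} \<in> E \<and> l v \<le> l z" by blast
      have "independent_set E (insert u I)"
        using I(1,2) assms(2) unfolding independent_set_def W_def by (auto simp: insert_commute)
      moreover have "\<exists>z\<in>insert u I. {v, z} \<in> E \<and> l v \<le> l z" if "v \<in> V - insert u I" for v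
        using that I(3)[of v] top[of v] unfolding W_def by blast
      ultimately show ?thesis
        using I(1) u(1) unfolding W_def by (intro exI[of _ "insert u I"]) auto
    qed
  qed
  then show thesis using that by blast
qed

lemma ex_independent_set_lowering_mad:
  assumes G: "simple_graph V E" and mad: "mad_at_most V E \<mu>" and "\<mu> < \<nu>"
  obtains I where "I \<subseteq> V" "independent_set E I" "mad_at_most (V - I) E (\<nu> - 1)"
proof -
  define m where "m = real ((card V)\<^sup>2)"
  define \<epsilon> where "\<epsilon> = (\<nu> - \<mu>) / (2 * (m + 1))"
  have "0 \<le> m" unfolding m_def by simp
  then have \<epsilon>: "0 < \<epsilon>" and "(m + 1) * (2 * \<epsilon>) = \<nu> - \<mu>"
    using assms(3) unfolding \<epsilon>_def by (simp_all add: divide_simps algebra_simps)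
  then have gap: "m * (2 * \<epsilon>) \<le> \<nu> - \<mu>"
    by (simp add: distrib_right)
  obtain x where x: "edge_split E x" "balanced V \<epsilon> x"
    using ex_balanced_edge_split[OF G, of \<epsilon>] \<epsilon> by auto
  have load: "load V x v \<le> \<nu>" if "v \<in> V" for v
    using load_le_mad_plus_gap[OF G x(1) mad _ that balanced_load_le[OF x]] \<epsilon> gap
    unfolding m_def by simp
  note fin = simple_graph_finite(1)[OF G]
  have "{v} \<notin> E" for v
    using simple_graph_edgeD(3)[OF G, of v v] by auto
  from ex_independent_set_dominating_upwards[OF fin this, of "load V x"]
  obtain I where I: "I \<subseteq> V" "independent_set E I"
    and dom: "\<And>v. v \<in> V - I \<Longrightarrow> \<exists>z\<in>I. {v, z} \<in> E \<and> load V x v \<le> load V x z" by blast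
  have "load (V - I) x v \<le> \<nu> - 1" if v: "v \<in> V - I" for v
  proof -
    obtain z where z: "z \<in> I" "{v, z} \<in> E" "load V x v \<le> load V x z"
      using dom[OF v] by blast
    have "load (V - I) x v + x (v, z) \<le> load V x v"
      using z(1) I(1) by (intro load_add_share_le[OF x(1) fin]) auto
    then show ?thesis
      using balanced_share_ge_1[OF x \<epsilon> z(2,3)] load[of v] v by simp
  qed
  then have "mad_at_most (V - I) E (\<nu> - 1)"
    using fin by (intro mad_at_most_if_load_le[OF G x(1)]) auto
  then show thesis
    using that I by blast
qed

theorem theorem9:
  fixes V :: "'a set" and E :: "'a set set" and M :: real and d :: nat
  assumes "simple_graph V E"
    and "M < 3"
    and "d > 0"
    and "mad V E < M"
    and "real d > 2 / (3 - M) - 2"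
  shows "\<exists>A B. A \<union> B = V \<and> A \<inter> B = {} \<and> independent_set E A \<and>
           forest B (induced_edges E B) \<and>
           (\<forall>x\<in>B. card (component B (induced_edges E B) x) \<le> d + 1)"
proof -
  obtain A where A: "A \<subseteq> V" "independent_set E A" "mad_at_most (V - A) E (M - 1)"
    using ex_independent_set_lowering_mad[OF assms(1) mad_at_most_mad[OF assms(1)] assms(4)] .
  define B where "B = V - A"
  let ?F = "induced_edges E B"
  have mad: "mad_at_most B ?F (M - 1)"
    using A(3) unfolding B_def by (simp add: mad_at_most_induced_edges)
  have fin: "finite B" "finite ?F"
    using simple_graph_finite[OF assms(1)] unfolding B_def by (auto intro: finite_induced_edges)
  have "forest B ?F"
    using forest_if_mad_at_most[OF fin(2) mad] assms(2) by simp
  moreover have "card (component B ?F x) \<le> d + 1" if "x \<in> B" for x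
  proof -
    have "real (card (component B ?F x)) \<le> 2 / (3 - M)"
      using card_component_bound_if_mad_at_most[OF fin mad that] assms(2)
      by (simp add: field_simps)
    then show ?thesis using assms(5) by linarith
  qed
  ultimately show ?thesis
    using A(1,2) unfolding B_def by (intro exI[of _ A] exI[of _ "V - A"]) auto
qed

end
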